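(* Let $G$ be a dense subset of $\mathbb{R}$ that contains $1$. Then there is a non-trivial moment sequence $(t_0,t_1,t_2,\dots)$ such that $t_n$ belongs to $G$ for every $n\in\mathbb{N}_0$. Furthermore, the moment sequences with all terms belonging to $G$ constitute a dense subset (in the topology of pointwise convergence, i.e. the product topology) of the set $\mathcal{M}$ of all moment sequences. If $G$ also is a group (a subgroup of $\mathbb{R}$) and has infinite rank over $\mathbb{Q}$, then there exists a moment sequence with all terms in $G$ whose terms are linearly independent over $\mathbb{Q}$.
   Context: $\mathbb{N}_0=\{0,1,2,\dots\}$. A (Hausdorff) moment sequence is a sequence $t=(t(0),t(1),t(2),\dots)$ of real numbers for which there is a Borel probability measure $\mu$ on $[0,1]$ with $t(n)=\int_0^1\lambda^n\,d\mu(\lambda)$ for all $n\ge 0$ (with $\lambda^0=1$, so $t(0)=1$). $\mathcal{M}$ denotes the set of all moment sequences. A moment sequence is trivial if the corresponding measure $\mu$ is supported in $\{0,1\}$, and non-trivial otherwise. *)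

theory Defs
  imports "HOL-Probability.Probability" "HOL-Algebra.Group"
begin

definition represents :: "real measure \<Rightarrow> (nat \<Rightarrow> real) \<Rightarrow> bool" where
  "represents \<mu> t \<longleftrightarrow>
     prob_space \<mu> \<and> sets \<mu> = sets (restrict_space borel {0..1}) \<and>
     (\<forall>n. t n = (\<integral>x. x ^ n \<partial>\<mu>))"

definition moment_sequences :: "(nat \<Rightarrow> real) set" where
  "moment_sequences = {t. \<exists>\<mu>. represents \<mu> t}"

text \<open>The representing measure is unique (Hausdorff), so quantifying existentially over it
  is a way to speak about the measure that corresponds to \<open>t\<close>. The set \<open>{0, 1}\<close> is closed,
  so \<open>\<mu>\<close> is supported in it iff its complement in \<open>[0, 1]\<close> is a null set.\<close>

definition trivial_moment_sequence :: "(nat \<Rightarrow> real) \<Rightarrow> bool" where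
  "trivial_moment_sequence t \<longleftrightarrow>
     (\<exists>\<mu>. represents \<mu> t \<and> emeasure \<mu> ({0..1} - {0, 1}) = 0)"

definition real_add_group :: "real monoid" where
  "real_add_group = \<lparr>carrier = UNIV, monoid.mult = (+), one = 0\<rparr>"

global_interpretation rat_real: vector_space "\<lambda>(q::rat) (x::real). of_rat q * x"
  by unfold_locales (simp_all add: algebra_simps of_rat_add of_rat_mult)

text \<open>The rank is the cardinality of a maximal linearly independent subset. All such subsets
  have the same cardinality, so the rank is infinite iff some infinite subset is independent.
  The library's \<open>dim\<close> cannot be used, as it is \<open>0\<close> in infinite dimension.\<close>

definition infinite_rat_rank :: "real set \<Rightarrow> bool" where
  "infinite_rat_rank G \<longleftrightarrow> (\<exists>B\<subseteq>G. infinite B \<and> rat_real.independent B)"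

text \<open>Independence of the family \<open>(t n)\<close>, not only of its set of values: injectivity excludes
  repeated terms.\<close>

definition rat_independent_seq :: "(nat \<Rightarrow> real) \<Rightarrow> bool" where
  "rat_independent_seq t \<longleftrightarrow> inj t \<and> rat_real.independent (range t)"

end

theory Submission
  imports Defs "HOL-Computational_Algebra.Polynomial"
begin

text \<open>Mix a given moment sequence with a little of the moments of a density on $[0, 1]$ that is
  a series of orthogonal polynomials, starting with the constant 1. The coefficient of the
  polynomial of degree \<open>n\<close> leaves the earlier moments unchanged and moves the \<open>n\<close>-th one over an
  interval, so the moments can be steered one after the other into any dense sets, even ones that
  depend on the moments already chosen: \<open>G\<close> itself, or \<open>G\<close> without the rational span of the
  earlier moments.\<close>

section \<open>Divisibility and higher derivatives of polynomials\<close>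

text \<open>By the product rule for \<open>a ^ Suc m * q\<close>, both summands keep a factor
  \<open>a ^ m\<close>: each derivative costs at most one factor.\<close>

lemma power_dvd_pderiv:
  fixes a p :: "'a :: idom poly"
  assumes "a ^ Suc m dvd p"
  shows "a ^ m dvd pderiv p"
proof -
  obtain q where "p = a ^ Suc m * q"
    using assms by (elim dvdE)
  then have "pderiv p = a ^ Suc m * pderiv q + q * (smult (of_nat (Suc m)) (a ^ m) * pderiv a)"
    by (simp only: pderiv_mult pderiv_power_Suc)
  also have "\<dots> = a ^ m * (a * pderiv q + smult (of_nat (Suc m)) (pderiv a * q))"
    by (simp add: algebra_simps del: of_nat_Suc)
  finally show ?thesis
    by simp
qed

lemma power_dvd_higher_pderiv:
  fixes a p :: "'a :: idom poly"
  assumes "a ^ (m + j) dvd p"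
  shows "a ^ m dvd (pderiv ^^ j) p"
  using assms
proof (induction j arbitrary: m)
  case (Suc j)
  then have "a ^ Suc m dvd (pderiv ^^ j) p"
    using Suc.IH[of "Suc m"] by simp
  then show ?case
    by (simp add: power_dvd_pderiv)
qed simp

text \<open>Together with the next lemma this evaluates the moments of Rodrigues' polynomial once
  all derivatives have been moved to the monomial.\<close>

lemma higher_pderiv_monom_less:
  "k < n \<Longrightarrow> (pderiv ^^ n) (monom (1 :: 'a :: idom) k) = 0"
  by (rule poly_eqI) (simp add: coeff_higher_pderiv)

lemma higher_pderiv_monom_same:
  "(pderiv ^^ n) (monom (1 :: 'a :: {idom, semiring_char_0}) n) = [:fact n:]"
  by (rule poly_eqI)
    (auto simp: coeff_higher_pderiv coeff_pCons pochhammer_fact split: nat.splits)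

section \<open>Integration by parts and orthogonal polynomials\<close>

lemma set_integrable_poly [simp]: "set_integrable lborel {0..1} (\<lambda>x::real. poly p x)"
  by (intro borel_integrable_atLeastAtMost' continuous_intros)

lemma integral_poly_pderiv:
  fixes q :: "real poly"
  shows "(LBINT x:{0..1}. poly (pderiv q) x) = poly q 1 - poly q 0"
  unfolding set_lebesgue_integral_def
  by (rule integral_FTC_atLeastAtMost)
    (auto intro!: continuous_intros DERIV_subset[OF poly_DERIV]
      simp flip: has_real_derivative_iff_has_vector_derivative)

text \<open>Integration by parts, repeated \<open>j\<close> times. No boundary terms occur:
  derivatives of \<open>g\<close> of order less than \<open>n\<close> are still divisible by
  \<open>a\<close>, which vanishes at 0 and 1.\<close>

lemma integral_mult_higher_pderiv:
  fixes a g q :: "real poly"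
  assumes "a ^ n dvd g" "poly a 0 = 0" "poly a 1 = 0" "j \<le> n"
  shows "(LBINT x:{0..1}. poly (q * (pderiv ^^ j) g) x) =
    (-1) ^ j * (LBINT x:{0..1}. poly ((pderiv ^^ j) q * g) x)"
  using \<open>j \<le> n\<close>
proof (induction j arbitrary: q)
  case (Suc j)
  define h where "h = (pderiv ^^ j) g"
  have "a ^ (1 + j) dvd g"
    using Suc.prems by (intro dvd_trans[OF le_imp_power_dvd assms(1)]) simp
  then have "a dvd h"
    using power_dvd_higher_pderiv[of a 1 j g] by (simp add: h_def)
  then have "poly h 0 = 0" "poly h 1 = 0"
    using assms(2,3) by (auto elim!: dvdE)
  then have "(LBINT x:{0..1}. poly (pderiv (q * h)) x) = 0"
    by (simp add: integral_poly_pderiv)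
  then have "(LBINT x:{0..1}. poly (q * pderiv h) x + poly (pderiv q * h) x) = 0"
    by (simp add: pderiv_mult algebra_simps)
  then have "(LBINT x:{0..1}. poly (q * pderiv h) x) + (LBINT x:{0..1}. poly (pderiv q * h) x) = 0"
    by (subst (asm) set_integral_add) (simp_all only: set_integrable_poly)
  then show ?case
    using Suc.IH[of "pderiv q"] Suc.prems by (simp add: h_def funpow_swap1)
qed simp

text \<open>The integrand is nonnegative on the unit interval and at least
  \<open>(3 / 16) ^ n\<close> on its middle half, 3/16 being the value of \<open>x * (1 - x)\<close>
  at 1/4 and 3/4.\<close>

lemma integral_power_bernstein_pos:
  "(LBINT x:{0..1}. (x * (1 - x)) ^ n) > (0 :: real)"
proof -
  have "0 < (LBINT x:{1/4..3/4::real}. (3 / 16 :: real) ^ n)"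
    by (simp add: set_lebesgue_integral_def)
  also have "\<dots> \<le> (LBINT x:{0..1}. (x * (1 - x)) ^ n)"
    unfolding set_lebesgue_integral_def
  proof (rule integral_mono)
    show "integrable lborel (\<lambda>x. indicator {1/4..3/4::real} x *\<^sub>R (3 / 16 :: real) ^ n)"
      by (intro borel_integrable_compact compact_Icc continuous_intros)
    show "integrable lborel (\<lambda>x. indicator {0..1::real} x *\<^sub>R (x * (1 - x)) ^ n)"
      by (intro borel_integrable_compact compact_Icc continuous_intros)
    fix x :: real
    have "3 / 16 \<le> x * (1 - x)" if "1 / 4 \<le> x" "x \<le> 3 / 4"
    proof -
      have "0 \<le> (x - 1 / 4) * (3 / 4 - x)"
        using that by simp
      also have "\<dots> = x * (1 - x) - 3 / 16"
        by (simp add: field_simps)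
      finally show ?thesis
        by simp
    qed
    then show "indicator {1/4..3/4} x *\<^sub>R (3 / 16 :: real) ^ n \<le> indicator {0..1} x *\<^sub>R (x * (1 - x)) ^ n"
      by (auto simp: indicator_def intro!: power_mono)
  qed
  finally show ?thesis .
qed

text \<open>Up to a scalar these are the shifted Legendre polynomials, given by Rodrigues' formula.\<close>

lemma ex_orthogonal_poly:
  fixes B :: real
  assumes "B > 0"
  shows "\<exists>p::real poly. (\<forall>k<n. (LBINT x:{0..1}. poly p x * x ^ k) = 0) \<and>
    (LBINT x:{0..1}. poly p x * x ^ n) \<noteq> 0 \<and> (\<forall>x\<in>{0..1}. \<bar>poly p x\<bar> \<le> B)"
proof -
  define a where "a = [:0, 1, -1::real:]"
  define p where "p = (pderiv ^^ n) (a ^ n)"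
  have *: "(LBINT x:{0..1}. poly p x * x ^ k) =
      (-1) ^ n * (LBINT x:{0..1}. poly ((pderiv ^^ n) (monom 1 k) * a ^ n) x)" for k
    using integral_mult_higher_pderiv[of a n "a ^ n" n "monom 1 k"]
    by (simp add: p_def a_def poly_monom mult.commute)
  have orth: "(LBINT x:{0..1}. poly p x * x ^ k) = 0" if "k < n" for k
    using that by (simp add: * higher_pderiv_monom_less)
  \<comment> \<open>The \<open>n\<close>-th derivative of the monomial is the constant
    \<open>fact n\<close>, so a positive integral remains up to a nonzero factor.\<close>
  have "(LBINT x:{0..1}. poly p x * x ^ n) = (-1) ^ n * (fact n * (LBINT x:{0..1}. (x * (1 - x)) ^ n))"
    by (simp add: * higher_pderiv_monom_same a_def algebra_simps flip: set_integral_mult_right)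
  then have nz: "(LBINT x:{0..1}. poly p x * x ^ n) \<noteq> 0"
    using integral_power_bernstein_pos[of n] by simp
  have "bounded (poly p ` {0..1})"
    by (intro compact_imp_bounded compact_continuous_image continuous_intros compact_Icc)
  then obtain C where C: "C > 0" "\<And>x. x \<in> {0..1} \<Longrightarrow> \<bar>poly p x\<bar> \<le> C"
    by (auto simp: bounded_pos)
  \<comment> \<open>Rescaling by a positive factor turns the bound \<open>C\<close> into
    \<open>B\<close> and preserves which integrals vanish.\<close>
  define r where "r = B / C"
  have r: "r > 0"
    using C assms by (simp add: r_def)
  have "\<bar>poly (smult r p) x\<bar> \<le> B" if "x \<in> {0..1}" for x
    using mult_left_mono[OF C(2)[OF that], of r] C(1) r assms by (simp add: abs_mult r_def)
  moreover have "(LBINT x:{0..1}. poly (smult r p) x * x ^ k) = r * (LBINT x:{0..1}. poly p x * x ^ k)" for k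
    by (simp add: mult.assoc flip: set_integral_mult_right)
  ultimately show ?thesis
    using orth nz r by (intro exI[of _ "smult r p"]) auto
qed

section \<open>Bounds and constructions for moment sequences\<close>

lemma represents_moment_bounds:
  assumes "represents \<mu> t"
  shows "t n \<in> {0..1}" and "t 0 = 1"
proof -
  interpret prob_space \<mu>
    using assms by (simp add: represents_def)
  have s: "sets \<mu> = sets (restrict_space borel {0..1})"
    using assms by (simp add: represents_def)
  have sp: "space \<mu> = {0..1}"
    using sets_eq_imp_space_eq[OF s] by (simp add: space_restrict_space)
  have t: "t n = (\<integral>x. x ^ n \<partial>\<mu>)" for n
    using assms by (simp add: represents_def)
  have [measurable]: "(\<lambda>x. x ^ n) \<in> borel_measurable \<mu>"
    by (subst measurable_cong_sets[OF s refl]) (auto intro!: measurable_restrict_space1)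
  have i: "integrable \<mu> (\<lambda>x. x ^ n)"
    by (rule integrable_const_bound[where B=1]) (auto simp: sp power_le_one intro!: AE_I2)
  show "t n \<in> {0..1}"
    unfolding t
    by (auto simp: sp power_le_one intro!: integral_le_const[OF i] integral_ge_const[OF i] AE_I2)
  show "t 0 = 1"
    by (simp add: t prob_space)
qed

text \<open>The mixture of the two measures is obtained as a monadic bind: a Bernoulli variable
  selects \<open>\<nu>\<close> with probability \<open>a\<close> and \<open>\<mu>\<close> otherwise.
  Integrals against a bind are iterated integrals, which gives the weights.\<close>

lemma moment_sequences_convex_comb:
  assumes "s \<in> moment_sequences" "t \<in> moment_sequences" and a: "0 \<le> a" "a \<le> 1"
  shows "(\<lambda>n. (1 - a) * s n + a * t n) \<in> moment_sequences"
proof -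
  let ?R = "restrict_space borel {0..1::real}"
  obtain \<mu> \<nu> where *: "represents \<mu> s" "represents \<nu> t"
    using assms by (auto simp: moment_sequences_def)
  define K where "K b = (if b then \<nu> else \<mu>)" for b
  let ?P = "measure_pmf (bernoulli_pmf a)"
  have K: "prob_space (K b)" "sets (K b) = sets ?R" for b
    using * by (auto simp: K_def represents_def)
  have Km: "K \<in> ?P \<rightarrow>\<^sub>M prob_algebra ?R"
    using K by (auto simp: space_prob_algebra)
  then have Ks: "K \<in> ?P \<rightarrow>\<^sub>M subprob_algebra ?R"
    by (rule measurable_prob_algebraD)
  have P: "?P \<in> space (prob_algebra (count_space UNIV))"
    by (auto simp: space_prob_algebra intro: measure_pmf.prob_space_axioms)
  have Km': "K \<in> count_space UNIV \<rightarrow>\<^sub>M prob_algebra ?R"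
    using Km by simp
  have "(\<integral>x. x ^ n \<partial>(?P \<bind> K)) = (1 - a) * s n + a * t n" for n
  proof -
    have "(\<integral>x. x ^ n \<partial>(?P \<bind> K)) = (\<integral>b. (\<integral>x. x ^ n \<partial>K b) \<partial>?P)"
      using K(1)[THEN prob_space.emeasure_space_1]
      by (intro integral_bind[where K="?R" and B=1 and B'=1] Ks measure_pmf.finite_measure_axioms)
        (auto simp: space_restrict_space power_le_one intro!: measurable_restrict_space1)
    also have "\<dots> = (1 - a) * s n + a * t n"
      using * a by (simp add: K_def represents_def)
    finally show ?thesis .
  qed
  then have "represents (?P \<bind> K) (\<lambda>n. (1 - a) * s n + a * t n)"
    using prob_space_bind'[OF P Km'] sets_bind'[OF P Km'] by (simp add: represents_def)
  then show ?thesis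
    by (auto simp: moment_sequences_def)
qed

lemma density_moments_mem_moment_sequences:
  assumes [measurable]: "f \<in> borel_measurable borel"
    and nn: "\<And>x. x \<in> {0..1} \<Longrightarrow> 0 \<le> f x"
    and int: "set_integrable lborel {0..1} f" "(LBINT x:{0..1}. f x) = 1"
  shows "(\<lambda>n. LBINT x:{0..1}. f x * x ^ n) \<in> moment_sequences"
proof -
  let ?L = "restrict_space lborel {0..1::real}"
  define \<mu> where "\<mu> = density ?L f"
  have sp: "space ?L = {0..1}"
    by (simp add: space_restrict_space)
  have [measurable]: "f \<in> borel_measurable ?L" "(\<lambda>x. x ^ n) \<in> borel_measurable ?L" for n
    by (auto intro!: measurable_restrict_space1)
  have ae: "AE x in ?L. 0 \<le> f x"
    using nn by (auto intro!: AE_I2 simp: sp)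
  have L: "integral\<^sup>L ?L g = (LBINT x:{0..1}. g x)" for g :: "real \<Rightarrow> real"
    by (simp add: integral_restrict_space set_lebesgue_integral_def)
  have "integrable ?L f"
    using int(1) by (simp add: integrable_restrict_space set_integrable_def)
  then have "(\<integral>\<^sup>+x. f x \<partial>?L) = 1"
    using ae by (subst nn_integral_eq_integral) (auto simp: L int(2))
  moreover have "emeasure \<mu> (space \<mu>) = (\<integral>\<^sup>+x. f x \<partial>?L)"
    unfolding \<mu>_def by (subst emeasure_density) (auto intro!: nn_integral_cong simp: sp sets_restrict_space_iff)
  ultimately have "prob_space \<mu>"
    by (intro prob_spaceI) simp
  moreover have "sets \<mu> = sets (restrict_space borel {0..1})"
    unfolding \<mu>_def sets_density by (rule sets_restrict_space_cong) simp
  moreover have "(\<integral>x. x ^ n \<partial>\<mu>) = (LBINT x:{0..1}. f x * x ^ n)" for n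
    unfolding \<mu>_def by (subst integral_density) (auto simp: L ae)
  ultimately show ?thesis
    by (auto simp: moment_sequences_def represents_def)
qed


section \<open>Steering the moments into dense sets\<close>

text \<open>The sequence is $(1 - \eta) m$ plus \<open>\<eta>\<close> times the moments of the density
  $1 + \sum_k e_k p_k$, where \<open>p k\<close> is orthogonal to all monomials of degree less than \<open>k\<close> and
  bounded by $2^{-k-1}$. Its \<open>n\<close>-th term depends only on the \<open>e k\<close> with \<open>k \<le> n\<close>, and is a
  nonconstant affine function of \<open>e n\<close>.\<close>

lemma ex_moment_sequence_near:
  fixes A :: "real set \<Rightarrow> real set"
  assumes m: "m \<in> moment_sequences" and \<eta>: "0 < \<eta>" "\<eta> \<le> 1"
    and dense: "\<And>F. finite F \<Longrightarrow> closure (A F) = UNIV"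
  shows "\<exists>t\<in>moment_sequences. (\<forall>n>0. t n \<in> A (t ` {..<n})) \<and> (\<forall>n. \<bar>t n - m n\<bar> \<le> \<eta>)"
proof -
  have "\<exists>p :: nat \<Rightarrow> real poly. \<forall>n. (\<forall>k<n. (LBINT x:{0..1}. poly (p n) x * x ^ k) = 0) \<and>
    (LBINT x:{0..1}. poly (p n) x * x ^ n) \<noteq> 0 \<and> (\<forall>x\<in>{0..1}. \<bar>poly (p n) x\<bar> \<le> (1 / 2) ^ Suc n)"
    by (intro choice allI ex_orthogonal_poly) simp
  then obtain p :: "nat \<Rightarrow> real poly" where
    orth: "\<And>n k. k < n \<Longrightarrow> (LBINT x:{0..1}. poly (p n) x * x ^ k) = 0" and
    nz: "\<And>n. (LBINT x:{0..1}. poly (p n) x * x ^ n) \<noteq> 0" and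
    bound: "\<And>n x. x \<in> {0..1} \<Longrightarrow> \<bar>poly (p n) x\<bar> \<le> (1 / 2) ^ Suc n"
    by blast
  define c where "c k n = (LBINT x:{0..1}. poly (p k) x * x ^ n)" for k n
  define L where "L n = (LBINT x:{0..1::real}. x ^ n)" for n :: nat
  \<comment> \<open>The value of the \<open>n\<close>-th term if the \<open>n\<close>-th coefficient
    is \<open>r\<close>; of \<open>e\<close> only the coefficients before \<open>n\<close>
    enter.\<close>
  define T where "T e n r = (1 - \<eta>) * m n + \<eta> * (L n + (\<Sum>k<n. e k * c k n) + r * c n n)"
    for e :: "nat \<Rightarrow> real" and n r
  \<comment> \<open>Admissibility of \<open>r\<close> as the \<open>n\<close>-th coefficient. At 0
    the coefficient must be 0, since the density has to keep total mass 1.\<close>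
  define P where "P e n r \<longleftrightarrow> \<bar>r\<bar> \<le> 1 \<and>
      (if n = 0 then r = 0 else T e n r \<in> A ((\<lambda>j. T e j (e j)) ` {..<n}))"
    for e :: "nat \<Rightarrow> real" and n r
  have "\<exists>e. \<forall>n. P e n (e n)"
  \<comment> \<open>The target set at \<open>n\<close> depends on all earlier choices, so the
    coefficients are chosen by well-founded recursion; the first goal says that \<open>P\<close>
    looks only at \<open>e\<close> below \<open>n\<close>.\<close>
  proof (rule dependent_wellorder_choice)
    fix r n and e e' :: "nat \<Rightarrow> real"
    assume eq: "\<And>j. j < n \<Longrightarrow> e j = e' j"
    then have "T e j s = T e' j s" if "j \<le> n" for j s
      using that by (simp add: T_def)
    with eq show "P e n r = P e' n r"
      by (simp add: P_def cong: image_cong_simp)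
  next
    fix n and e :: "nat \<Rightarrow> real"
    define B where "B = A ((\<lambda>j. T e j (e j)) ` {..<n})"
    have pos: "\<eta> * \<bar>c n n\<bar> > 0"
      using \<eta> nz[of n] by (simp add: c_def)
    \<comment> \<open>As \<open>r\<close> runs over the interval from -1 to 1,
      \<open>T e n r\<close> covers all points within \<open>\<eta> * \<bar>c n n\<bar>\<close> of
      \<open>T e n 0\<close>. A dense set has a point \<open>y\<close> there, and solving for
      \<open>r\<close> gives the coefficient.\<close>
    have "T e n 0 \<in> closure B"
      by (simp add: B_def dense)
    then obtain y where y: "y \<in> B" "\<bar>y - T e n 0\<bar> < \<eta> * \<bar>c n n\<bar>"
      using pos by (auto simp: closure_approachable dist_real_def)
    define r where "r = (y - T e n 0) / (\<eta> * c n n)"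
    have "\<bar>r\<bar> \<le> 1"
      using y(2) pos \<eta> by (simp add: r_def abs_mult divide_simps)
    moreover have "T e n r = T e n 0 + r * (\<eta> * c n n)"
      by (simp add: T_def algebra_simps)
    moreover have "r * (\<eta> * c n n) = y - T e n 0"
      using nz[of n] \<eta> by (simp add: r_def c_def)
    ultimately show "\<exists>r. P e n r"
      using y(1) by (cases "n = 0") (auto simp: P_def B_def)
  qed
  then obtain e where e: "\<And>n. P e n (e n)"
    by blast
  have e1: "\<bar>e n\<bar> \<le> 1" for n
    using e[of n] by (simp add: P_def)
  have e0: "e 0 = 0"
    using e[of 0] by (simp add: P_def)
  define t where "t n = T e n (e n)" for n
  have t_mem: "t n \<in> A (t ` {..<n})" if "0 < n" for n
    using e[of n] that by (simp add: P_def t_def cong: image_cong_simp)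

  define g where "g x = (\<Sum>k. e k * poly (p k) x)" for x
  have bd: "\<bar>e k * poly (p k) x\<bar> \<le> (1 / 2) ^ Suc k" if "x \<in> {0..1}" for k x
    using mult_mono[OF e1[of k] bound[OF that, of k]] by (simp add: abs_mult)
  \<comment> \<open>The bounds on the \<open>p k\<close> add up to exactly 1, so
    \<open>\<bar>g x\<bar> \<le> 1\<close> and the density \<open>1 + g x\<close> is
    nonnegative.\<close>
  have geom: "(\<lambda>k. (1 / 2 :: real) ^ Suc k) sums 1"
    using power_half_series by simp
  have summ: "summable (\<lambda>k. \<bar>e k * poly (p k) x\<bar>)" if "x \<in> {0..1}" for x
    using bd[OF that] by (intro summable_comparison_test_ev[OF _ sums_summable[OF geom]]) auto
  have g1: "\<bar>g x\<bar> \<le> 1" if "x \<in> {0..1}" for x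
  proof -
    have "\<bar>g x\<bar> \<le> (\<Sum>k. \<bar>e k * poly (p k) x\<bar>)"
      unfolding g_def by (rule summable_rabs[OF summ[OF that]])
    also have "\<dots> \<le> (\<Sum>k. (1 / 2) ^ Suc k)"
      by (intro suminf_le bd[OF that] summ[OF that] sums_summable[OF geom])
    finally show ?thesis
      using geom by (simp add: sums_iff)
  qed
  have [measurable]: "poly q \<in> borel_measurable borel" for q :: "real poly"
    by (intro borel_measurable_continuous_onI continuous_intros)
  have [measurable]: "g \<in> borel_measurable borel"
    unfolding g_def by measurable
  have L_int: "set_integrable lborel {0..1} (\<lambda>x::real. x ^ n)" for n
    by (intro borel_integrable_atLeastAtMost' continuous_intros)
  have g_int: "set_integrable lborel {0..1} (\<lambda>x. g x * x ^ n)" (is ?int)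
    and g_moment: "(LBINT x:{0..1}. g x * x ^ n) = (\<Sum>k<Suc n. e k * c k n)" (is ?moment) for n
  proof -
    \<comment> \<open>Sum and integral may be interchanged, because the norms of the
      \<open>F k\<close> are dominated by a geometric series, both pointwise and in
      integral.\<close>
    define F where "F k x = indicator {0..1} x *\<^sub>R (e k * poly (p k) x * x ^ n)" for k x
    have F_int: "integrable lborel (F k)" for k
    proof -
      have "set_integrable lborel {0..1} (\<lambda>x. e k * poly (p k) x * x ^ n)"
        by (intro borel_integrable_atLeastAtMost' continuous_intros)
      then show ?thesis
        by (simp add: F_def[abs_def] set_integrable_def)
    qed
    have F_bd: "norm (F k x) \<le> indicator {0..1} x *\<^sub>R (1 / 2) ^ Suc k" for k x
      using mult_mono[OF bd[of x k] power_le_one[of "\<bar>x\<bar>" n]]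
      by (auto simp: F_def indicator_def abs_mult power_abs)
    have F_summ: "summable (\<lambda>k. norm (F k x))" for x
    proof (rule summable_comparison_test'[OF sums_summable[OF geom]])
      show "norm (norm (F k x)) \<le> (1 / 2) ^ Suc k" if "0 \<le> k" for k
        using F_bd[of k x] by (cases "x \<in> {0..1}") simp_all
    qed
    have "(\<integral>x. norm (F k x) \<partial>lborel) \<le> (1 / 2) ^ Suc k" for k
    proof -
      have "(\<integral>x. norm (F k x) \<partial>lborel) \<le> (LBINT x:{0..1::real}. (1 / 2) ^ Suc k)"
        unfolding set_lebesgue_integral_def using L_int[of 0] F_int F_bd
        by (intro integral_mono) (auto simp: set_integrable_def)
      then show ?thesis
        by (simp add: set_lebesgue_integral_def)
    qed
    then have F_summ_int: "summable (\<lambda>k. \<integral>x. norm (F k x) \<partial>lborel)"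
      by (intro summable_comparison_test_ev[OF _ sums_summable[OF geom]]) auto
    have F_sum: "(\<Sum>k. F k x) = indicator {0..1} x *\<^sub>R (g x * x ^ n)" for x
      using suminf_mult2[OF summable_rabs_cancel[OF summ], of x "x ^ n"]
      by (cases "x \<in> {0..1}") (simp_all add: F_def g_def)
    show ?int
      using integrable_suminf[OF F_int _ F_summ_int] F_summ
      by (simp add: set_integrable_def F_sum)
    have F_eq: "integral\<^sup>L lborel (F k) = e k * c k n" for k
      by (simp add: F_def[abs_def] c_def mult.assoc set_lebesgue_integral_def flip: integral_mult_right_zero)
        (simp add: ac_simps)
    have "(LBINT x:{0..1}. g x * x ^ n) = (\<Sum>k. e k * c k n)"
      using integral_suminf[OF F_int _ F_summ_int] F_summ
      by (simp add: set_lebesgue_integral_def F_sum F_eq)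
    \<comment> \<open>Orthogonality ends the series: \<open>c k n\<close> is 0 for
      \<open>k > n\<close>.\<close>
    also have "\<dots> = (\<Sum>k<Suc n. e k * c k n)"
      by (rule suminf_finite) (auto simp: c_def orth not_less_eq)
    finally show ?moment .
  qed
  define u where "u n = (LBINT x:{0..1}. (1 + g x) * x ^ n)" for n
  have u: "u n = L n + (\<Sum>k<Suc n. e k * c k n)" for n
    unfolding u_def L_def g_moment[symmetric]
    by (subst set_integral_add(2)[symmetric]) (auto simp: L_int g_int algebra_simps)
  have "L 0 = 1"
    by (simp add: L_def set_lebesgue_integral_def)
  have "u \<in> moment_sequences"
    unfolding u_def
  proof (rule density_moments_mem_moment_sequences)
    show "set_integrable lborel {0..1} (\<lambda>x. 1 + g x)"
      using set_integral_add(1)[OF L_int[of 0] g_int[of 0]] by simp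
    show "(LBINT x:{0..1}. 1 + g x) = 1"
      using u[of 0] \<open>L 0 = 1\<close> by (simp add: u_def e0)
    show "0 \<le> 1 + g x" if "x \<in> {0..1}" for x
      using g1[OF that] by linarith
  qed measurable
  moreover have t_eq: "t = (\<lambda>n. (1 - \<eta>) * m n + \<eta> * u n)"
    by (simp add: t_def T_def u fun_eq_iff add.assoc)
  ultimately have "t \<in> moment_sequences"
    using m \<eta> by (simp add: moment_sequences_convex_comb)
  moreover have "\<bar>t n - m n\<bar> \<le> \<eta>" for n
  proof -
    \<comment> \<open>Two moments differ by at most 1, so mixing with weight \<open>\<eta>\<close>
      moves each term by at most \<open>\<eta>\<close>.\<close>
    have "m n \<in> {0..1}" "u n \<in> {0..1}"
      using m \<open>u \<in> moment_sequences\<close> represents_moment_bounds(1)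
      unfolding moment_sequences_def by blast+
    then have "\<bar>u n - m n\<bar> \<le> 1"
      by auto
    moreover have "t n - m n = \<eta> * (u n - m n)"
      by (simp add: t_eq algebra_simps)
    ultimately show ?thesis
      using mult_left_mono[of "\<bar>u n - m n\<bar>" 1 \<eta>] \<eta> by (simp add: abs_mult)
  qed
  ultimately show ?thesis
    using t_mem by (intro bexI[of _ t]) auto
qed

section \<open>Trivial sequences and point masses\<close>

text \<open>On the set \<open>{0, 1}\<close> the functions \<open>x\<close> and \<open>x ^ 2\<close>
  agree. The contrapositive serves as a test for non-triviality.\<close>

lemma trivial_moment_sequence_imp_eq:
  assumes "trivial_moment_sequence t"
  shows "t 1 = t 2"
proof -
  obtain \<mu> where \<mu>: "represents \<mu> t" "emeasure \<mu> ({0..1} - {0, 1}) = 0"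
    using assms by (auto simp: trivial_moment_sequence_def)
  have s: "sets \<mu> = sets (restrict_space borel {0..1})"
    using \<mu> by (simp add: represents_def)
  have sp: "space \<mu> = {0..1}"
    using sets_eq_imp_space_eq[OF s] by (simp add: space_restrict_space)
  have pm: "(\<lambda>x. x ^ n) \<in> borel_measurable \<mu>" for n
    by (subst measurable_cong_sets[OF s refl]) (auto intro!: measurable_restrict_space1)
  have "{0..1} - {0, 1} \<in> sets \<mu>"
    by (simp add: s sets_restrict_space_iff)
  then have "AE x in \<mu>. x \<notin> {0..1} - {0, 1}"
    using \<mu>(2) by (intro AE_not_in) (auto simp: null_sets_def)
  then have "AE x in \<mu>. x ^ 1 = x ^ 2"
    using AE_space by eventually_elim (auto simp: sp)
  then have "(\<integral>x. x ^ 1 \<partial>\<mu>) = (\<integral>x. x ^ 2 \<partial>\<mu>)"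
    by (intro integral_cong_AE pm)
  then show ?thesis
    using \<mu>(1) by (simp only: represents_def)
qed

text \<open>The point mass at \<open>x\<close> has these moments. The case 1/2 later supplies a
  concrete sequence to perturb.\<close>

lemma power_mem_moment_sequences:
  assumes "x \<in> {0..1}"
  shows "(\<lambda>n. x ^ n) \<in> moment_sequences"
proof -
  let ?R = "restrict_space borel {0..1::real}"
  have x: "x \<in> space ?R"
    using assms by (simp add: space_restrict_space)
  have "(\<integral>y. y ^ n \<partial>return ?R x) = x ^ n" for n
    by (intro integral_return x) (auto intro!: measurable_restrict_space1)
  then have "represents (return ?R x) (\<lambda>n. x ^ n)"
    using prob_space_return[OF x] by (simp add: represents_def)
  then show ?thesis
    by (auto simp: moment_sequences_def)
qed

section \<open>Rational independence and density outside a span\<close>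

text \<open>Initial segments are independent by induction, and the union of a chain of independent
  sets is independent.\<close>

lemma (in vector_space) independent_sequence:
  fixes t :: "nat \<Rightarrow> 'b"
  assumes "\<And>n. t n \<notin> span (t ` {..<n})"
  shows "inj t" and "independent (range t)"
proof -
  show "inj t"
  proof (rule linorder_injI)
    fix i j :: nat
    assume "i < j"
    then have "t i \<in> span (t ` {..<j})"
      by (intro span_base) simp
    then show "t i \<noteq> t j"
      using assms[of j] by metis
  qed
  have "independent (t ` {..<n})" for n
    by (induction n) (simp_all add: lessThan_Suc independent_empty independent_insertI assms)
  then have "independent (\<Union>n. t ` {..<n})"
  proof (intro independent_Union_directed)
    fix c d
    assume "c \<in> range (\<lambda>n. t ` {..<n})" "d \<in> range (\<lambda>n. t ` {..<n})"
    then obtain i j where "c = t ` {..<i}" "d = t ` {..<j}"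
      by auto
    then show "c \<subseteq> d \<or> d \<subseteq> c"
      using linear[of i j] by (auto intro: image_mono)
  qed auto
  moreover have "(\<Union>n. t ` {..<n}) = range t"
    by auto
  ultimately show "independent (range t)"
    by simp
qed

lemma subgroup_real_add_group_diff:
  assumes "subgroup G real_add_group" "x \<in> G" "y \<in> G"
  shows "x - y \<in> G"
proof -
  interpret group real_add_group
    by (rule groupI) (auto simp: real_add_group_def intro: exI[of _ "- _"])
  have "inv\<^bsub>real_add_group\<^esub> y = - y"
    by (intro inv_equality) (auto simp: real_add_group_def)
  then show ?thesis
    using subgroup.m_closed[OF assms(1,2) subgroup.m_inv_closed[OF assms(1,3)]]
    by (simp add: real_add_group_def)
qed

text \<open>A positive element \<open>h\<close> of \<open>G\<close> in the span cannot be the end of the search for small elements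
  outside it: reduce an outside element of \<open>G\<close> modulo \<open>h\<close>.\<close>

lemma dense_diff_span:
  assumes dense: "closure G = UNIV" and sub: "subgroup G real_add_group"
    and rank: "infinite_rat_rank G" and fin: "finite F"
  shows "closure (G - rat_real.span F) = UNIV"
proof -
  have diff: "x - y \<in> G" if "x \<in> G" "y \<in> G" for x y
    using subgroup_real_add_group_diff[OF sub that] .
  have zero: "0 \<in> G"
    using subgroup.one_closed[OF sub] by (simp add: real_add_group_def)
  have add: "x + y \<in> G" if "x \<in> G" "y \<in> G" for x y
    using diff[OF that(1) diff[OF zero that(2)]] by simp
  have mult: "of_int k * h \<in> G" if "h \<in> G" for k h
    by (induction k rule: int_induct[where k=0]) (auto simp: algebra_simps zero intro: add diff that)
  have near: "\<exists>y\<in>G. \<bar>y - x\<bar> < d" if "d > 0" for x d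
    using dense that by (auto simp: closure_approachable dist_real_def set_eq_iff)
  obtain B where B: "B \<subseteq> G" "infinite B" "rat_real.independent B"
    using rank by (auto simp: infinite_rat_rank_def)
  \<comment> \<open>An independent set inside the span of the finite set \<open>F\<close> would be
    finite.\<close>
  then have "\<not> B \<subseteq> rat_real.span F"
    using rat_real.independent_span_bound[OF fin] by blast
  then obtain g where g: "g \<in> G" "g \<notin> rat_real.span F"
    using B by blast
  have small: "\<exists>s\<in>G - rat_real.span F. \<bar>s\<bar> < d" if "d > 0" for d
  proof -
    \<comment> \<open>An approximation of \<open>d / 2\<close> with error below \<open>d / 2\<close>
      lies strictly between 0 and \<open>d\<close>.\<close>
    obtain h where h: "h \<in> G" "\<bar>h - d / 2\<bar> < d / 2"
      using near[of "d / 2" "d / 2"] \<open>d > 0\<close> by auto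
    then have h': "0 < h" "h < d"
      by (auto simp: abs_less_iff field_simps)
    show ?thesis
    proof (cases "h \<in> rat_real.span F")
      case True
      \<comment> \<open>The remainder \<open>g - of_int k * h\<close> lies between 0 and
        \<open>h\<close>, and it stays outside the span because the subtracted multiple of
        \<open>h\<close> is in it.\<close>
      define k where "k = \<lfloor>g / h\<rfloor>"
      have "of_int k * h \<in> rat_real.span F"
        using rat_real.span_scale[OF True, of "of_int k"] by simp
      then have "g - of_int k * h \<notin> rat_real.span F"
        using g(2) rat_real.span_add[of "g - of_int k * h" F "of_int k * h"] by auto
      moreover have "0 \<le> g - of_int k * h" "g - of_int k * h < h"
        using floor_divide_lower[OF h'(1), of g] floor_divide_upper[OF h'(1), of g]
        by (simp_all add: k_def algebra_simps)
      ultimately show ?thesis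
        using h' g h by (intro bexI[of _ "g - of_int k * h"]) (auto intro: diff mult)
    qed (use h h' in \<open>auto intro!: bexI[of _ h]\<close>)
  qed
  have "x \<in> closure (G - rat_real.span F)" for x
    unfolding closure_approachable dist_real_def
  proof (intro allI impI)
    fix d :: real
    assume "d > 0"
    obtain y where y: "y \<in> G" "\<bar>y - x\<bar> < d / 2"
      using near[of "d / 2" x] \<open>d > 0\<close> by auto
    obtain s where s: "s \<in> G" "s \<notin> rat_real.span F" "\<bar>s\<bar> < d / 2"
      using small[of "d / 2"] \<open>d > 0\<close> by auto
    show "\<exists>y\<in>G - rat_real.span F. \<bar>y - x\<bar> < d"
    \<comment> \<open>If the approximation \<open>y\<close> falls into the span, adding the small
      outside element \<open>s\<close> leaves the span while the total error stays below
      \<open>d\<close>.\<close>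
    proof (cases "y \<in> rat_real.span F")
      case True
      then have "y + s \<notin> rat_real.span F"
        using s(2) rat_real.span_add_eq[of y F s] by blast
      then show ?thesis
        using y s abs_triangle_ineq[of "y - x" s]
        by (intro bexI[of _ "y + s"]) (auto simp: algebra_simps intro: add)
    qed (use y \<open>d > 0\<close> in \<open>auto intro!: bexI[of _ y]\<close>)
  qed
  then show ?thesis
    by auto
qed

section \<open>Existence, density and independence for a dense set\<close>

theorem theorem4p6:
  fixes G :: "real set"
  assumes "closure G = UNIV" and "1 \<in> G"
  shows "(\<exists>t\<in>moment_sequences. \<not> trivial_moment_sequence t \<and> (\<forall>n. t n \<in> G)) \<and>
    moment_sequences \<subseteq> closure {t \<in> moment_sequences. \<forall>n. t n \<in> G} \<and>
    (subgroup G real_add_group \<and> infinite_rat_rank G \<longrightarrow>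
       (\<exists>t\<in>moment_sequences. (\<forall>n. t n \<in> G) \<and> rat_independent_seq t))"
proof (intro conjI impI)
  have t0: "t 0 = 1" if "t \<in> moment_sequences" for t
    using that represents_moment_bounds(2) by (auto simp: moment_sequences_def)
  have near: "\<exists>t\<in>moment_sequences. (\<forall>n. t n \<in> G) \<and> (\<forall>n. \<bar>t n - m n\<bar> \<le> \<eta>)"
    if m: "m \<in> moment_sequences" and \<eta>: "0 < \<eta>" "\<eta> \<le> 1" for m \<eta>
  proof -
    obtain t where t: "t \<in> moment_sequences" "\<forall>n>0. t n \<in> G" "\<forall>n. \<bar>t n - m n\<bar> \<le> \<eta>"
      using ex_moment_sequence_near[OF m \<eta>, of "\<lambda>_. G"] assms(1) by blast
    \<comment> \<open>The term at 0 is not steered; it equals 1, which is why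
      \<open>1 \<in> G\<close> is assumed.\<close>
    moreover have "t n \<in> G" for n
      using t(2) t0[OF t(1)] assms(2) by (cases "n = 0") auto
    ultimately show ?thesis
      by blast
  qed
  have half: "(\<lambda>n. (1 / 2 :: real) ^ n) \<in> moment_sequences"
    by (rule power_mem_moment_sequences) simp
  show "\<exists>t\<in>moment_sequences. \<not> trivial_moment_sequence t \<and> (\<forall>n. t n \<in> G)"
  proof -
    \<comment> \<open>The moments 1/2 and 1/4 of the point mass at 1/2 differ by 1/4; two errors of
      at most 1/16 cannot make them equal.\<close>
    obtain t where t: "t \<in> moment_sequences" "\<forall>n. t n \<in> G" "\<And>n. \<bar>t n - (1 / 2) ^ n\<bar> \<le> 1 / 16"
      using near[OF half, of "1 / 16"] by auto
    have "t 1 \<noteq> t 2"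
    proof -
      have "\<bar>t 1 - 1 / 2\<bar> \<le> 1 / 16" "\<bar>t 2 - 1 / 4\<bar> \<le> 1 / 16"
        using t(3)[of 1] t(3)[of 2] by (simp_all add: power2_eq_square)
      then show ?thesis
        by linarith
    qed
    then show ?thesis
      using t trivial_moment_sequence_imp_eq by blast
  qed
  show "moment_sequences \<subseteq> closure {t \<in> moment_sequences. \<forall>n. t n \<in> G}" (is "_ \<subseteq> closure ?S")
  proof
    fix m :: "nat \<Rightarrow> real"
    assume m: "m \<in> moment_sequences"
    have "\<exists>f. \<forall>j. f j \<in> ?S \<and> (\<forall>n. \<bar>f j n - m n\<bar> \<le> inverse (real (Suc j)))"
    proof (intro choice allI)
      show "\<exists>t. t \<in> ?S \<and> (\<forall>n. \<bar>t n - m n\<bar> \<le> inverse (real (Suc j)))" for j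
        using near[OF m, of "inverse (real (Suc j))"] by (auto simp: inverse_le_1_iff)
    qed
    then obtain f where f: "\<And>j. f j \<in> ?S" "\<And>j n. \<bar>f j n - m n\<bar> \<le> inverse (real (Suc j))"
      by blast
    have "(\<lambda>j. f j n) \<longlonglongrightarrow> m n" for n
    proof (rule LIM_zero_cancel, rule Lim_null_comparison[OF _ LIMSEQ_inverse_real_of_nat])
      show "\<forall>\<^sub>F j in sequentially. norm (f j n - m n) \<le> inverse (real (Suc j))"
        using f(2) by (intro always_eventually) simp
    qed
    \<comment> \<open>Convergence in each coordinate is convergence in the product topology, which
      is the topology of the function type.\<close>
    then have "limitin (product_topology (\<lambda>_. euclidean) UNIV) f m sequentially"
      by (simp add: limitin_componentwise)
    then have "f \<longlonglongrightarrow> m"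
      by (simp add: euclidean_product_topology)
    moreover have "f j \<in> closure ?S" for j
      by (rule subsetD[OF closure_subset f(1)])
    ultimately show "m \<in> closure ?S"
      using Lim_in_closed_set[OF closed_closure always_eventually trivial_limit_sequentially] by blast
  qed
  assume *: "subgroup G real_add_group \<and> infinite_rat_rank G"
  define A where "A F = G - rat_real.span F" for F
  have dense: "closure (A F) = UNIV" if "finite F" for F
    using dense_diff_span[OF assms(1)] * that by (simp add: A_def)
  \<comment> \<open>With \<open>\<eta>\<close> equal to 1 the mixture consists of the moments of the
    steered density alone; each term after the first avoids the span of its predecessors.\<close>
  obtain t where t: "t \<in> moment_sequences" "\<forall>n>0. t n \<in> A (t ` {..<n})"
    using ex_moment_sequence_near[OF half zero_less_one order_refl, of A, OF dense] by blast
  \<comment> \<open>For \<open>n = 0\<close> the span of the empty set is \<open>{0}\<close>, which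
    does not contain the term 1.\<close>
  have "t n \<in> A (t ` {..<n})" for n
    using t(2) t0[OF t(1)] assms(2) by (cases "n = 0") (auto simp: A_def)
  then have "\<forall>n. t n \<in> G" "rat_independent_seq t"
    using rat_real.independent_sequence[of t] by (auto simp: A_def rat_independent_seq_def)
  then show "\<exists>t\<in>moment_sequences. (\<forall>n. t n \<in> G) \<and> rat_independent_seq t"
    using t(1) by blast
qed

end
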